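(* Fix an integer $d\geq 2$ and let $\mathcal{A}$ be the set of all vectors $a=(\alpha_1,\ldots,\alpha_d)$ with $\alpha_i>0$ and $2\sum_{i=1}^d\alpha_i=1$. For $a\in\mathcal{A}$ let $\mathbf{S}_t(a,d)$ be the symmetric random walk in $\mathbb{Z}^d$ defined by $\mathbf{S}_0=\mathbf{0}$, $\mathbf{S}_t=\mathbf{S}_{t-1}+\mathbf{e}_t$ ($t\geq1$), where the $\mathbf{e}_t$ are i.i.d., independent of the past, and $\mathsf{P}\{\mathbf{e}_t=\mathbf{1}_i\}=\mathsf{P}\{\mathbf{e}_t=-\mathbf{1}_i\}=\alpha_i$, $i=1,\ldots,d$. Then the family $\{\mathbf{S}_t(a,d): a\in\mathcal{A}\}$ is $(\mathcal{A},d)$-conservative, and it is characterized by the birth-and-death process with parameters $\lambda_n(2,d)$, $\mu_n(2,d)$: specifically, for every $a\in\mathcal{A}$ and every $n\geq1$, $$p^{(a,d)}(n)=\frac{\lambda_n(2,d)}{\lambda_n(2,d)+\mu_n(2,d)},$$ where for $\gamma>0$ and $n\geq1$ $$\mu_n(\gamma,d)=\sum_{i=1}^d i\gamma^{i}\binom{d}{i}\binom{n-1}{i-1},\qquad \lambda_n(\gamma,d)=\mu_n(\gamma,d)+\gamma\sum_{i=1}^{d-1}(d-i)\gamma^{i}\binom{d}{i}\binom{n-1}{i-1}.$$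
   Context: $\mathbf{1}_i$ denotes the $i$th unit vector of $\mathbb{Z}^d$ and $\|\mathbf{n}\|=\sum_{i=1}^d|n^{(i)}|$. For a random walk $\mathbf{S}_t$ the active time instants are $t_1=\inf\{t>0:\|\mathbf{S}_t\|>0\}$ and $t_j=\inf\{t>t_{j-1}:\|\mathbf{S}_t\|\neq\|\mathbf{S}_{t_{j-1}}\|\}$ for $j\geq2$. For a walk $\mathbf{S}_t(a,d)$ in a family indexed by a parameter set $\mathcal{A}$, set $P^{(a,d)}_{t_j}(n)=\mathsf{P}\{\|\mathbf{S}_{t_{j+1}}(a,d)\|=n+1\mid \|\mathbf{S}_{t_j}(a,d)\|=n\}$ and $p^{(a,d)}(n)=\lim_{j\to\infty}P^{(a,d)}_{t_j}(n)$. The family is called $(\mathcal{A},d)$-conservative if these limits exist and, for all $a_1,a_2\in\mathcal{A}$ and all $n\geq0$, $p^{(a_1,d)}(n)=p^{(a_2,d)}(n)$.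
   Formalization: The limit defining p(n) is taken along those j for which the event ‖S_{t_j}‖ = n has positive probability (infinitely many, and this is proved), since for j of parity opposite to n the conditional probability is undefined. *)

theory Defs
  imports "HOL-Probability.Probability"
begin

text \<open>Lattice points of Z^d are functions from a finite index type 'd (with CARD('d) = d) to int.\<close>

definition unit_vec :: "'d \<Rightarrow> ('d \<Rightarrow> int)" where
  "unit_vec i = (\<lambda>k. if k = i then 1 else 0)"

definition l1norm :: "('d::finite \<Rightarrow> int) \<Rightarrow> int" where
  "l1norm x = (\<Sum>k\<in>UNIV. \<bar>x k\<bar>)"

definition param_set :: "('d::finite \<Rightarrow> real) set" where
  "param_set = {a. (\<forall>i. a i > 0) \<and> 2 * (\<Sum>i\<in>UNIV. a i) = 1}"

definition step_pmf :: "('d::finite \<Rightarrow> real) \<Rightarrow> ('d \<Rightarrow> int) pmf" where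
  "step_pmf a = embed_pmf (\<lambda>v. \<Sum>i\<in>UNIV.
      if v = unit_vec i \<or> v = (\<lambda>k. - unit_vec i k) then a i else 0)"

definition walk_space :: "('d::finite \<Rightarrow> real) \<Rightarrow> ('d \<Rightarrow> int) stream measure" where
  "walk_space a = stream_space (measure_pmf (step_pmf a))"

definition walk :: "('d \<Rightarrow> int) stream \<Rightarrow> nat \<Rightarrow> ('d \<Rightarrow> int)" where
  "walk \<omega> t = (\<lambda>k. \<Sum>s<t. (\<omega> !! s) k)"

text \<open>Active time instants: t_0 = 0 (so that t_1 = inf{t>0. ||S_t|| > 0}),
  t_{j+1} = inf{t > t_j. ||S_t|| \<noteq> ||S_{t_j}||}.\<close>
fun active_time :: "('d::finite \<Rightarrow> int) stream \<Rightarrow> nat \<Rightarrow> nat" where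
  "active_time \<omega> 0 = 0"
| "active_time \<omega> (Suc j) = (LEAST t. t > active_time \<omega> j \<and>
      l1norm (walk \<omega> t) \<noteq> l1norm (walk \<omega> (active_time \<omega> j)))"

definition cond_event :: "('d::finite \<Rightarrow> real) \<Rightarrow> nat \<Rightarrow> nat \<Rightarrow> ('d \<Rightarrow> int) stream set" where
  "cond_event a j n = {\<omega> \<in> space (walk_space a). l1norm (walk \<omega> (active_time \<omega> j)) = int n}"

definition joint_event :: "('d::finite \<Rightarrow> real) \<Rightarrow> nat \<Rightarrow> nat \<Rightarrow> ('d \<Rightarrow> int) stream set" where
  "joint_event a j n = {\<omega> \<in> cond_event a j n.
      l1norm (walk \<omega> (active_time \<omega> (Suc j))) = int n + 1}"

definition P_tj :: "('d::finite \<Rightarrow> real) \<Rightarrow> nat \<Rightarrow> nat \<Rightarrow> real" where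
  "P_tj a n j = measure (walk_space a) (joint_event a j n) / measure (walk_space a) (cond_event a j n)"

text \<open>The limit j \<rightarrow> \<infinity> is taken along those j for which the conditioning event has
  positive probability (conditional probability otherwise undefined).\<close>
definition adm_filter :: "('d::finite \<Rightarrow> real) \<Rightarrow> nat \<Rightarrow> nat filter" where
  "adm_filter a n = inf sequentially (principal {j. measure (walk_space a) (cond_event a j n) > 0})"

definition limit_exists :: "('d::finite \<Rightarrow> real) \<Rightarrow> nat \<Rightarrow> bool" where
  "limit_exists a n \<longleftrightarrow> (\<exists>\<^sub>\<infinity>j. measure (walk_space a) (cond_event a j n) > 0) \<and>
      (\<exists>L. (P_tj a n \<longlongrightarrow> L) (adm_filter a n))"

definition p_lim :: "('d::finite \<Rightarrow> real) \<Rightarrow> nat \<Rightarrow> real" where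
  "p_lim a n = Lim (adm_filter a n) (P_tj a n)"

definition conservative :: "('d::finite \<Rightarrow> real) set \<Rightarrow> bool" where
  "conservative A \<longleftrightarrow> (\<forall>a\<in>A. \<forall>n. limit_exists a n) \<and>
      (\<forall>a1\<in>A. \<forall>a2\<in>A. \<forall>n. p_lim a1 n = p_lim a2 n)"

definition mu_bd :: "nat \<Rightarrow> real \<Rightarrow> nat \<Rightarrow> real" where
  "mu_bd n \<gamma> d = (\<Sum>i=1..d. real i * \<gamma> ^ i * real (d choose i) * real ((n - 1) choose (i - 1)))"

definition lambda_bd :: "nat \<Rightarrow> real \<Rightarrow> nat \<Rightarrow> real" where
  "lambda_bd n \<gamma> d = mu_bd n \<gamma> d +
     \<gamma> * (\<Sum>i=1..d-1. real (d - i) * \<gamma> ^ i * real (d choose i) * real ((n - 1) choose (i - 1)))"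

end

theory Submission
  imports Defs "HOL-Library.Function_Algebras" "HOL-Real_Asymp.Real_Asymp"
begin

text \<open>
  Every step changes the norm by exactly 1, so almost surely the \<open>j\<close>-th active time is \<open>j\<close>, and
  the conditional probability is the average of the up-probabilities
  \<open>\<Sum>i. a i * (if x i = 0 then 2 else 1)\<close> over the sphere of radius \<open>n\<close>, weighted by
  \<open>P (S_j = x)\<close>.

  These weights become asymptotically uniform on the sphere, by an elementary ratio limit theorem.
  Let \<open>u m = P (S_2m = 0)\<close>. By symmetry \<open>u m\<close> is the sum of the squares of \<open>P (S_m = y)\<close>, so the
  Cauchy-Schwarz inequality shows that \<open>u (m + 1) / u m\<close> increases and that
  \<open>P (S_2m = x) \<le> u m\<close>. Since \<open>S_m\<close> takes only polynomially many values, \<open>u m\<close> decays at most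
  polynomially, so the limit of the ratios is 1, and the Chapman-Kolmogorov equation yields
  \<open>P (S_2m = x) / u m \<rightarrow> 1\<close> for every \<open>x\<close> of even norm; one further step settles odd norms.

  Under the uniform distribution on the sphere all coordinates vanish with the same probability,
  so the parameters \<open>a\<close> enter only through their sum. There are
  \<open>2 ^ i * (d choose i) * ((n - 1) choose (i - 1))\<close> points on the sphere with \<open>i\<close> nonzero
  coordinates, which gives \<open>\<lambda>\<close> and \<open>\<mu>\<close>.
\<close>

section \<open>A ratio limit theorem for symmetric walks of polynomial growth\<close>

text \<open>For a finitely supported \<open>q\<close> this is the \<open>m\<close>-fold convolution
  power, that is, the law of the walk after \<open>m\<close> steps. The recursion over finite sums
  keeps the analysis free of measure theory; \<open>prob_walk_step\<close> connects it to the stream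
  space.\<close>

fun walk_prob :: "'g::ab_group_add pmf \<Rightarrow> nat \<Rightarrow> 'g \<Rightarrow> real" where
  "walk_prob q 0 x = (if x = 0 then 1 else 0)"
| "walk_prob q (Suc m) x = (\<Sum>v\<in>set_pmf q. pmf q v * walk_prob q m (x - v))"

locale symmetric_walk =
  fixes q :: "'g::ab_group_add pmf"
  assumes finite_steps: "finite (set_pmf q)"
    and symmetric: "pmf q (- v) = pmf q v"
begin

abbreviation "p \<equiv> walk_prob q"

definition supp :: "nat \<Rightarrow> 'g set" where
  "supp m = {x. p m x \<noteq> 0}"

definition u :: "nat \<Rightarrow> real" where
  "u m = p (2 * m) 0"

lemma p_nonneg: "p m x \<ge> 0"
  by (induction m arbitrary: x) (auto intro!: sum_nonneg)

lemma p_Suc_ge: "v \<in> set_pmf q \<Longrightarrow> pmf q v * p m (x - v) \<le> p (Suc m) x"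
  using sum_mono2[OF finite_steps, of "{v}" "\<lambda>v. pmf q v * p m (x - v)"]
  by (simp add: p_nonneg)

lemma p_Suc_pos:
  assumes "v \<in> set_pmf q" "p m (x - v) > 0" shows "p (Suc m) x > 0"
proof -
  have "0 < pmf q v * p m (x - v)"
    using assms by (simp add: pmf_positive)
  also have "\<dots> \<le> p (Suc m) x" by (rule p_Suc_ge[OF assms(1)])
  finally show ?thesis .
qed

lemma sum_steps: "(\<Sum>v\<in>set_pmf q. pmf q v) = 1"
  by (rule sum_pmf_eq_1[OF finite_steps]) simp

lemma finite_supp: "finite (supp m)"
proof (induction m)
  case 0
  have "supp 0 \<subseteq> {0}" by (auto simp: supp_def)
  then show ?case by (rule finite_subset) simp
next
  case (Suc m)
  have "supp (Suc m) \<subseteq> (\<Union>v\<in>set_pmf q. (\<lambda>x. x + v) ` supp m)"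
  proof
    fix x assume "x \<in> supp (Suc m)"
    then obtain v where "v \<in> set_pmf q" "p m (x - v) \<noteq> 0"
      by (auto simp: supp_def elim!: sum.not_neutral_contains_not_neutral)
    then show "x \<in> (\<Union>v\<in>set_pmf q. (\<lambda>x. x + v) ` supp m)"
      by (force simp: supp_def image_iff)
  qed
  then show ?case using Suc finite_steps by (auto intro: finite_subset)
qed

lemma p_minus: "p m (- x) = p m x"
proof (induction m arbitrary: x)
  case (Suc m)
  have "p (Suc m) (- x) = (\<Sum>v\<in>set_pmf q. pmf q v * p m (x + v))"
    using Suc[of "x + v" for v] by simp
  also have "\<dots> = (\<Sum>v\<in>set_pmf q. pmf q v * p m (x - v))"
    by (rule sum.reindex_bij_witness[of _ uminus uminus])
       (auto simp: symmetric set_pmf_iff)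
  finally show ?case by simp
qed auto

text \<open>Induction on \<open>k\<close>: one step is peeled off the second stretch and the two
  finite sums are exchanged.\<close>

lemma chapman_kolmogorov: "p (m + k) x = (\<Sum>y\<in>supp m. p m y * p k (x - y))"
proof (induction k arbitrary: x)
  case 0
  have "(\<Sum>y\<in>supp m. p m y * p 0 (x - y)) = (\<Sum>y\<in>supp m. if y = x then p m y else 0)"
    by (rule sum.cong) auto
  also have "\<dots> = p m x" using finite_supp by (simp add: supp_def)
  finally show ?case by simp
next
  case (Suc k)
  have "p (m + Suc k) x
      = (\<Sum>v\<in>set_pmf q. pmf q v * (\<Sum>y\<in>supp m. p m y * p k (x - v - y)))"
    using Suc by simp
  also have "\<dots> = (\<Sum>y\<in>supp m. \<Sum>v\<in>set_pmf q. pmf q v * (p m y * p k (x - v - y)))"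
    unfolding sum_distrib_left by (rule sum.swap)
  also have "\<dots> = (\<Sum>y\<in>supp m. p m y * p (Suc k) (x - y))"
    by (simp add: sum_distrib_left algebra_simps)
  finally show ?case .
qed

section \<open>Return probabilities as sums of squares\<close>

lemma u_eq_sum_squares: "u m = (\<Sum>y\<in>supp m. (p m y)\<^sup>2)"
  unfolding u_def mult_2 chapman_kolmogorov by (simp add: p_minus power2_eq_square)

text \<open>As \<open>y\<close> runs through \<open>B\<close>, the points \<open>x - y\<close> are
  distinct, so this is a partial sum of the squares that add up to \<open>u m\<close>.\<close>

lemma sum_squares_le_u:
  assumes "finite B" shows "(\<Sum>y\<in>B. (p m (x - y))\<^sup>2) \<le> u m"
proof -
  have "(\<Sum>y\<in>B. (p m (x - y))\<^sup>2) = (\<Sum>z\<in>(\<lambda>y. x - y) ` B. (p m z)\<^sup>2)"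
    by (subst sum.reindex) (auto simp: inj_on_def)
  also have "\<dots> = (\<Sum>z\<in>(\<lambda>y. x - y) ` B \<inter> supp m. (p m z)\<^sup>2)"
    using assms by (intro sum.mono_neutral_right) (auto simp: supp_def)
  also have "\<dots> \<le> (\<Sum>z\<in>supp m. (p m z)\<^sup>2)"
    by (intro sum_mono2 finite_supp) auto
  finally show ?thesis by (simp add: u_eq_sum_squares)
qed

text \<open>The path is split at its midpoint and 2 a b \<le> a^2 + b^2 is applied to each product;
  both sums of squares are at most \<open>u m\<close>.\<close>

lemma p_even_le_u: "p (2 * m) x \<le> u m"
proof -
  have "2 * p (2 * m) x = (\<Sum>y\<in>supp m. 2 * p m y * p m (x - y))"
    unfolding mult_2[of m] chapman_kolmogorov by (simp add: sum_distrib_left mult.assoc)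
  also have "\<dots> \<le> (\<Sum>y\<in>supp m. (p m y)\<^sup>2 + (p m (x - y))\<^sup>2)"
    by (intro sum_mono sum_squares_bound)
  also have "\<dots> \<le> u m + u m"
    using sum_squares_le_u[OF finite_supp[of m], of m x]
    by (simp add: sum.distrib u_eq_sum_squares)
  finally show ?thesis by simp
qed

text \<open>Stated for every finite superset of the support, so that the induction hypothesis
  applies to the translates of \<open>A\<close> by the steps.\<close>

lemma sum_p_eq_1:
  assumes "finite A" "supp m \<subseteq> A" shows "(\<Sum>x\<in>A. p m x) = 1"
  using assms
proof (induction m arbitrary: A)
  case 0
  then show ?case by (auto simp: supp_def)
next
  case (Suc m)
  have "(\<Sum>x\<in>A. p (Suc m) x) = (\<Sum>v\<in>set_pmf q. pmf q v * (\<Sum>x\<in>A. p m (x - v)))"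
    unfolding walk_prob.simps sum_distrib_left by (rule sum.swap)
  also have "\<dots> = (\<Sum>v\<in>set_pmf q. pmf q v)"
  proof (rule sum.cong[OF refl])
    fix v assume v: "v \<in> set_pmf q"
    have "supp m \<subseteq> (\<lambda>x. x - v) ` A"
    proof
      fix z assume "z \<in> supp m"
      then have "p m (z + v - v) > 0" using p_nonneg[of m z] by (simp add: supp_def)
      then have "p (Suc m) (z + v) > 0" by (rule p_Suc_pos[OF v])
      then have "z + v \<in> A" using Suc.prems by (auto simp: supp_def)
      then show "z \<in> (\<lambda>x. x - v) ` A" by (force simp: image_iff)
    qed
    then have "(\<Sum>x\<in>(\<lambda>x. x - v) ` A. p m x) = 1" using Suc by auto
    then show "pmf q v * (\<Sum>x\<in>A. p m (x - v)) = pmf q v"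
      by (subst (asm) sum.reindex) (auto simp: inj_on_def)
  qed
  finally show ?case by (simp add: sum_steps)
qed

text \<open>Cauchy-Schwarz for the total mass 1, which is spread over \<open>supp m\<close>.\<close>

lemma u_lower_bound: "1 \<le> u m * card (supp m)"
  using sum_squared_le_sum_of_squares[of "p m" "supp m"] sum_p_eq_1[OF finite_supp order_refl, of m]
    u_eq_sum_squares[of m] by simp

lemma u_pos: "u m > 0"
proof -
  have "u m \<ge> 0" by (simp add: u_def p_nonneg)
  moreover have "u m \<noteq> 0" using u_lower_bound[of m] by auto
  ultimately show ?thesis by simp
qed

text \<open>Splitting the 2 m + 2 steps of a return unevenly, into m and m + 2, makes Cauchy-Schwarz
  yield the two neighbours of \<open>u (Suc m)\<close>.\<close>

lemma u_log_convex: "(u (Suc m))\<^sup>2 \<le> u m * u (Suc (Suc m))"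
proof -
  have "u (Suc m) = p (m + (m + 2)) 0" by (simp add: u_def mult_2)
  also have "\<dots> = (\<Sum>y\<in>supp m. p m y * p (m + 2) (0 - y))" by (rule chapman_kolmogorov)
  finally have "(u (Suc m))\<^sup>2 = (\<Sum>y\<in>supp m. p m y * p (m + 2) (0 - y))\<^sup>2" by (rule arg_cong)
  also have "\<dots> \<le> (\<Sum>y\<in>supp m. (p m y)\<^sup>2) * (\<Sum>y\<in>supp m. (p (m + 2) (0 - y))\<^sup>2)"
    by (rule Cauchy_Schwarz_ineq_sum)
  also have "\<dots> \<le> u m * u (m + 2)"
    unfolding u_eq_sum_squares[of m, symmetric]
    by (intro mult_left_mono sum_squares_le_u finite_supp) (simp add: u_pos less_imp_le)
  finally show ?thesis by simp
qed

text \<open>After the first two steps, every continuation has probability at most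
  \<open>u m\<close>.\<close>

lemma u_Suc_le: "u (Suc m) \<le> u m"
proof -
  have "u (Suc m) = p (2 + 2 * m) 0" by (simp add: u_def)
  also have "\<dots> = (\<Sum>y\<in>supp 2. p 2 y * p (2 * m) (0 - y))" by (rule chapman_kolmogorov)
  also have "\<dots> \<le> (\<Sum>y\<in>supp 2. p 2 y * u m)"
    by (intro sum_mono mult_left_mono p_even_le_u p_nonneg)
  also have "\<dots> = u m"
    using sum_p_eq_1[OF finite_supp order_refl, of 2] by (simp flip: sum_distrib_right)
  finally show ?thesis .
qed

end

section \<open>Ratio limits under polynomial growth\<close>

locale polynomial_growth_walk = symmetric_walk +
  fixes D :: nat
  assumes growth: "card (supp m) \<le> (2 * m + 1) ^ D"
begin

text \<open>The ratios increase by log-convexity and are at most 1, so they converge; a limit below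
  1 would make \<open>u\<close> decay geometrically.\<close>

lemma u_Suc_ratio_tendsto: "(\<lambda>m. u (Suc m) / u m) \<longlonglongrightarrow> 1"
proof -
  define r where "r m = u (Suc m) / u m" for m
  have "incseq r"
  proof (rule incseq_SucI)
    show "r m \<le> r (Suc m)" for m
      using u_log_convex[of m] u_pos[of m] u_pos[of "Suc m"]
      by (simp add: r_def field_simps power2_eq_square)
  qed
  moreover have r_le: "r m \<le> 1" for m
    using u_Suc_le[of m] u_pos[of m] by (simp add: r_def)
  ultimately obtain L where L: "r \<longlonglongrightarrow> L" and le: "\<And>m. r m \<le> L"
    using incseq_convergent[of r 1] by blast
  have r0: "r m > 0" for m by (simp add: r_def u_pos)
  have "L \<le> 1" using L r_le LIMSEQ_le_const2 by blast
  moreover have "\<not> L < 1"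
  proof
    assume "L < 1"
    have "L > 0" using r0 le less_le_trans by blast
    \<comment> \<open>Since \<open>u 0 = 1\<close>, the value \<open>u m\<close> is a product of
      \<open>m\<close> ratios, each at most \<open>L\<close>.\<close>
    have u_le: "u m \<le> L ^ m" for m
    proof (induction m)
      case (Suc m)
      have "u (Suc m) = r m * u m" using u_pos[of m] by (simp add: r_def)
      also have "\<dots> \<le> L * L ^ m"
        using le r0 Suc u_pos \<open>L > 0\<close> by (intro mult_mono) (auto simp: less_imp_le)
      finally show ?case by simp
    qed (simp add: u_def)
    \<comment> \<open>By \<open>u_lower_bound\<close>, polynomial growth excludes exponential decay of \<^term>\<open>u\<close>.\<close>
    have "1 \<le> L ^ m * (2 * real m + 1) ^ D" for m
    proof -
      have "1 \<le> u m * card (supp m)" by (rule u_lower_bound)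
      also have "\<dots> \<le> L ^ m * (2 * real m + 1) ^ D"
        using u_le[of m] \<open>L > 0\<close> of_nat_mono[OF growth[of m], where ?'a = real]
        by (intro mult_mono) (auto simp: add.commute)
      finally show ?thesis .
    qed
    moreover have "(\<lambda>m. L ^ m * (2 * real m + 1) ^ D) \<longlonglongrightarrow> 0"
      using \<open>L < 1\<close> \<open>L > 0\<close> by real_asymp
    ultimately show False using LIMSEQ_le_const[of _ "0::real" 1] by fastforce
  qed
  ultimately show ?thesis using L by (simp add: r_def[abs_def])
qed

lemma u_add_ratio_tendsto: "(\<lambda>m. u (m + k) / u m) \<longlonglongrightarrow> 1"
proof (induction k)
  case 0
  then show ?case using u_pos by (simp add: less_imp_neq[symmetric])
next
  case (Suc k)
  have "(\<lambda>m. u (Suc (m + k)) / u (m + k)) \<longlonglongrightarrow> 1"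
    using LIMSEQ_ignore_initial_segment[OF u_Suc_ratio_tendsto, of k] .
  from tendsto_mult[OF this Suc] show ?case using u_pos by (simp add: less_imp_neq[symmetric])
qed

text \<open>The ratio \<^term>\<open>u (m + k) / u m\<close> is a weighted average of the quotients
  \<^term>\<open>p (2 * m) y / u m\<close>, none of which exceeds 1; if the average tends to 1, so does
  every quotient of positive weight.\<close>
lemma p_even_ratio_tendsto:
  assumes pos: "p (2 * k) x > 0"
  shows "(\<lambda>m. p (2 * m) x / u m) \<longlonglongrightarrow> 1"
proof -
  have ub: "p (2 * m) x / u m \<le> 1" for m
    using p_even_le_u[of m x] u_pos[of m] by simp
  have lb: "1 - (1 - u (m + k) / u m) / p (2 * k) x \<le> p (2 * m) x / u m" for m
  proof -
    \<comment> \<open>All summands are nonnegative by \<open>p_even_le_u\<close>, so the deficit at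
      \<open>x\<close> alone is bounded by the total deficit, which equals
      \<open>u m - u (m + k)\<close>.\<close>
    have "p (2 * k) x * (u m - p (2 * m) x) \<le> (\<Sum>y\<in>supp (2 * k). p (2 * k) y * (u m - p (2 * m) y))"
      using pos sum_mono2[OF finite_supp, of "{x}" "2 * k" "\<lambda>y. p (2 * k) y * (u m - p (2 * m) y)"]
      by (simp add: p_nonneg p_even_le_u supp_def)
    also have "\<dots> = (\<Sum>y\<in>supp (2 * k). p (2 * k) y) * u m - p (2 * k + 2 * m) 0"
      unfolding chapman_kolmogorov
      by (simp add: p_minus right_diff_distrib sum_subtractf sum_distrib_right)
    also have "\<dots> = u m - u (m + k)"
      using sum_p_eq_1[OF finite_supp order_refl, of "2 * k"]
      by (simp add: u_def add.commute)
    finally have "p (2 * k) x * (u m - p (2 * m) x) / u m \<le> (u m - u (m + k)) / u m"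
      using u_pos[of m] by (intro divide_right_mono) auto
    then have "(1 - p (2 * m) x / u m) * p (2 * k) x \<le> 1 - u (m + k) / u m"
      using u_pos[of m] by (simp add: diff_divide_distrib algebra_simps)
    then have "1 - p (2 * m) x / u m \<le> (1 - u (m + k) / u m) / p (2 * k) x"
      using pos by (simp only: pos_le_divide_eq)
    then show ?thesis by simp
  qed
  have "(\<lambda>m. 1 - (1 - u (m + k) / u m) / p (2 * k) x) \<longlonglongrightarrow> 1 - (1 - 1) / p (2 * k) x"
    using pos by (intro tendsto_intros u_add_ratio_tendsto) auto
  then have "(\<lambda>m. 1 - (1 - u (m + k) / u m) / p (2 * k) x) \<longlonglongrightarrow> 1" by simp
  then show ?thesis
    by (rule tendsto_sandwich[OF _ _ _ tendsto_const, rotated 2]) (auto simp: lb ub)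
qed

text \<open>Splitting off one step \<open>v\<close> gives a finite average of the even-time ratios
  at the points \<open>x - v\<close>.\<close>

lemma p_odd_ratio_tendsto:
  assumes "\<And>v. v \<in> set_pmf q \<Longrightarrow> \<exists>k. p (2 * k) (x - v) > 0"
  shows "(\<lambda>m. p (Suc (2 * m)) x / u m) \<longlonglongrightarrow> 1"
proof -
  have "(\<lambda>m. \<Sum>v\<in>set_pmf q. pmf q v * (p (2 * m) (x - v) / u m)) \<longlonglongrightarrow> (\<Sum>v\<in>set_pmf q. pmf q v * 1)"
    using assms by (intro tendsto_intros) (blast intro: p_even_ratio_tendsto)
  then show ?thesis by (simp add: sum_steps sum_divide_distrib)
qed

end

section \<open>Counting lattice points on the sphere\<close>

definition sphere_on :: "'d::finite set \<Rightarrow> nat \<Rightarrow> ('d \<Rightarrow> int) set" where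
  "sphere_on K n = {x. {i. x i \<noteq> 0} = K \<and> l1norm x = int n}"

text \<open>Sign choices times compositions of \<open>n\<close> into \<open>k\<close> positive
  parts. The cases \<open>n = 0\<close> and \<open>k = 0\<close> are separate because truncated
  subtraction would give wrong binomials there.\<close>

definition sphere_count :: "nat \<Rightarrow> nat \<Rightarrow> nat" where
  "sphere_count k n = (if n = 0 then (if k = 0 then 1 else 0)
     else if k = 0 then 0 else 2 ^ k * ((n - 1) choose (k - 1)))"

text \<open>Removing one nonzero coordinate leaves norm \<open>j < n\<close>, and the factor 2 is
  its sign. Algebraically this is Pascal's rule summed over \<open>n\<close>.\<close>

lemma sphere_count_Suc: "sphere_count (Suc k) n = 2 * (\<Sum>j<n. sphere_count k j)"
proof (induction n)
  case (Suc n)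
  have "sphere_count (Suc k) (Suc n) = sphere_count (Suc k) n + 2 * sphere_count k n"
    by (cases n; cases k) (auto simp: sphere_count_def algebra_simps)
  then show ?case using Suc by simp
qed (simp add: sphere_count_def)

lemma l1norm_upd:
  fixes x :: "'d::finite \<Rightarrow> int"
  shows "l1norm (x(i := v)) = l1norm x - \<bar>x i\<bar> + \<bar>v\<bar>"
proof -
  have "l1norm (x(i := v)) = \<bar>v\<bar> + (\<Sum>k\<in>UNIV - {i}. \<bar>x k\<bar>)"
    unfolding l1norm_def by (subst sum.remove[of _ i]) (auto intro!: sum.cong)
  moreover have "l1norm x = \<bar>x i\<bar> + (\<Sum>k\<in>UNIV - {i}. \<bar>x k\<bar>)"
    unfolding l1norm_def by (subst sum.remove[of _ i]) auto
  ultimately show ?thesis by simp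
qed

lemma l1norm_nonneg: "l1norm x \<ge> 0"
  by (simp add: l1norm_def sum_nonneg)

lemma abs_le_l1norm: "\<bar>x i\<bar> \<le> l1norm x"
  unfolding l1norm_def by (rule member_le_sum) auto

lemma finite_box: "finite {x :: 'd::finite \<Rightarrow> int. \<forall>i. \<bar>x i\<bar> \<le> N}"
  and card_box: "N \<ge> 0 \<Longrightarrow> card {x :: 'd::finite \<Rightarrow> int. \<forall>i. \<bar>x i\<bar> \<le> N} = nat (2 * N + 1) ^ CARD('d)"
proof -
  have eq: "{x :: 'd \<Rightarrow> int. \<forall>i. \<bar>x i\<bar> \<le> N} = (\<Pi>\<^sub>E i\<in>UNIV. {- N..N})"
    by (auto simp: PiE_UNIV_domain abs_le_iff Pi_iff minus_le_iff)
  show "finite {x :: 'd \<Rightarrow> int. \<forall>i. \<bar>x i\<bar> \<le> N}" unfolding eq by (intro finite_PiE) auto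
  assume "N \<ge> 0"
  then show "card {x :: 'd \<Rightarrow> int. \<forall>i. \<bar>x i\<bar> \<le> N} = nat (2 * N + 1) ^ CARD('d)"
    unfolding eq by (subst card_PiE) (auto simp: algebra_simps)
qed

lemma finite_sphere: "finite {x :: 'd::finite \<Rightarrow> int. l1norm x = n}"
  by (rule finite_subset[OF _ finite_box[of n]]) (auto intro: abs_le_l1norm)

lemma finite_sphere_on: "finite (sphere_on K n)"
  by (rule finite_subset[OF _ finite_sphere[of "int n"]]) (auto simp: sphere_on_def)


text \<open>Induction on the support: deleting coordinate \<open>i\<close> reproduces the recursion
  \<open>sphere_count_Suc\<close>.\<close>

lemma card_sphere_on: "card (sphere_on K n) = sphere_count (card K) n"
proof (induction K arbitrary: n rule: finite_induct[OF finite])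
  case 1
  have "sphere_on ({} :: 'a set) n = (if n = 0 then {\<lambda>_. 0} else {})"
    by (auto simp: sphere_on_def l1norm_def)
  then show ?case by (simp add: sphere_count_def)
next
  case (2 i K)
  \<comment> \<open>An element records the norm \<open>j\<close> left on \<open>K\<close>, the sign
    of coordinate \<open>i\<close>, and the point with that coordinate zeroed. The deleted entry has
    absolute value \<open>n - j\<close>, which is positive.\<close>
  define I where "I = (SIGMA js:{..<n} \<times> {- 1, 1 :: int}. sphere_on K (fst js))"
  have "bij_betw (\<lambda>(js, x). x(i := snd js * (int n - int (fst js)))) I (sphere_on (insert i K) n)"
  proof (rule bij_betwI[where g = "\<lambda>x. ((n - nat \<bar>x i\<bar>, sgn (x i)), x(i := 0))"], goal_cases)
    case 1
    have "x i = 0" if "x \<in> sphere_on K j" for x j using that \<open>i \<notin> K\<close> by (auto simp: sphere_on_def)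
    then show ?case by (auto simp: I_def sphere_on_def l1norm_upd abs_mult split: if_splits)
  next
    case 2
    show ?case
    proof
      fix x assume x: "x \<in> sphere_on (insert i K) n"
      then have "x i \<noteq> 0" "\<bar>x i\<bar> \<le> int n"
        using abs_le_l1norm[of x i] by (auto simp: sphere_on_def)
      then show "((n - nat \<bar>x i\<bar>, sgn (x i)), x(i := 0)) \<in> I"
        using x \<open>i \<notin> K\<close> by (auto simp: I_def sphere_on_def l1norm_upd sgn_if)
    qed
  next
    case (3 z)
    then obtain j s x where z: "z = ((j, s), x)" "j < n" "s = -1 \<or> s = 1" "x \<in> sphere_on K j"
      by (auto simp: I_def)
    have "x i = 0" using z(4) \<open>i \<notin> K\<close> by (auto simp: sphere_on_def)
    then have "x(i := 0) = x" by auto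
    then show ?case using z(1-3) by (auto simp: sgn_if abs_mult nat_diff_distrib)
  next
    case (4 x)
    then have "\<bar>x i\<bar> \<le> int n"
      using abs_le_l1norm[of x i] by (auto simp: sphere_on_def)
    then show ?case by (auto simp: fun_eq_iff sgn_if)
  qed
  then have "card (sphere_on (insert i K) n) = card I" by (simp add: bij_betw_same_card)
  also have "\<dots> = (\<Sum>js\<in>{..<n} \<times> {- 1, 1 :: int}. sphere_count (card K) (fst js))"
    unfolding I_def using 2 by (subst card_SigmaI) (auto simp: finite_sphere_on)
  also have "\<dots> = 2 * (\<Sum>j<n. sphere_count (card K) j)"
    by (simp add: sum.cartesian_product[symmetric, of "\<lambda>j s. sphere_count (card K) j",
          simplified case_prod_unfold] sum_distrib_left mult_2)
  finally show ?case using 2 by (simp add: sphere_count_Suc)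
qed

section \<open>Sums over the sphere and the rates \<lambda> and \<mu>\<close>

lemma sum_Pow_card:
  fixes f :: "nat \<Rightarrow> 'b::comm_semiring_1"
  assumes "finite A"
  shows "(\<Sum>K\<in>Pow A. f (card K)) = (\<Sum>i\<le>card A. of_nat (card A choose i) * f i)"
proof -
  have "(\<Sum>K\<in>Pow A. f (card K)) = (\<Sum>i\<le>card A. \<Sum>K\<in>{K\<in>Pow A. card K = i}. f (card K))"
    using assms by (intro sum.group[symmetric]) (auto intro: card_mono)
  also have "\<dots> = (\<Sum>i\<le>card A. of_nat (card A choose i) * f i)"
    using n_subsets[OF assms] by (intro sum.cong refl) (simp add: Pow_def)
  finally show ?thesis .
qed

text \<open>The points are grouped by their support and the supports by their size; the empty
  support drops out because \<open>n \<ge> 1\<close>.\<close>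

lemma sum_sphere_card_support:
  fixes g :: "nat \<Rightarrow> real"
  assumes "n \<ge> 1"
  shows "(\<Sum>x | l1norm (x :: 'd::finite \<Rightarrow> int) = int n. g (card {i. x i \<noteq> 0}))
    = (\<Sum>i=1..CARD('d). g i * 2 ^ i * real (CARD('d) choose i) * real ((n - 1) choose (i - 1)))"
proof -
  have "(\<Sum>x | l1norm (x :: 'd \<Rightarrow> int) = int n. g (card {i. x i \<noteq> 0}))
      = (\<Sum>K\<in>Pow UNIV. \<Sum>x | x \<in> {x. l1norm (x :: 'd \<Rightarrow> int) = int n} \<and> {i. x i \<noteq> 0} = K. g (card {i. x i \<noteq> 0}))"
    by (rule sum.group[symmetric]) (auto simp: finite_sphere)
  also have "\<dots> = (\<Sum>K\<in>Pow (UNIV :: 'd set). real (sphere_count (card K) n) * g (card K))"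
    by (rule sum.cong[OF refl]) (simp add: card_sphere_on[symmetric] sphere_on_def conj_commute)
  also have "\<dots> = (\<Sum>i\<le>CARD('d). real (CARD('d) choose i) * (real (sphere_count i n) * g i))"
    by (rule sum_Pow_card) simp
  also have "\<dots> = (\<Sum>i=1..CARD('d). real (CARD('d) choose i) * (real (sphere_count i n) * g i))"
    using assms by (intro sum.mono_neutral_right) (auto simp: sphere_count_def not_le)
  also have "\<dots> = (\<Sum>i=1..CARD('d). g i * 2 ^ i * real (CARD('d) choose i) * real ((n - 1) choose (i - 1)))"
    using assms by (intro sum.cong refl) (auto simp: sphere_count_def)
  finally show ?thesis .
qed

text \<open>Thus \<mu> counts the lattice edges from the sphere to the next smaller one: one for
  each nonzero coordinate.\<close>

lemma mu_bd_eq_sum_sphere: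
  assumes "n \<ge> 1"
  shows "mu_bd n 2 CARD('d::finite) = (\<Sum>x | l1norm (x :: 'd \<Rightarrow> int) = int n. real (card {i. x i \<noteq> 0}))"
  using sum_sphere_card_support[OF assms, of real, where ?'d = 'd] by (simp add: mu_bd_def)

lemma card_support_add_zeros: "card {i. x i \<noteq> 0} + card {i :: 'd::finite. x i = (0::int)} = CARD('d)"
proof -
  have "card ({i. x i \<noteq> 0} \<union> {i. x i = 0}) = card {i. x i \<noteq> 0} + card {i. x i = 0}"
    by (rule card_Un_disjoint) auto
  moreover have "{i. x i \<noteq> 0} \<union> {i. x i = 0} = UNIV" by auto
  ultimately show ?thesis by simp
qed

text \<open>Thus \<lambda> counts the edges to the next larger sphere: one for each nonzero
  coordinate and two for each zero coordinate.\<close>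

lemma lambda_bd_eq_sum_sphere:
  assumes "n \<ge> 1"
  shows "lambda_bd n 2 CARD('d::finite) = mu_bd n 2 CARD('d) +
    2 * (\<Sum>x | l1norm (x :: 'd \<Rightarrow> int) = int n. real (card {i. x i = 0}))"
proof -
  have "(\<Sum>x | l1norm (x :: 'd \<Rightarrow> int) = int n. real (card {i. x i = 0}))
      = (\<Sum>x | l1norm (x :: 'd \<Rightarrow> int) = int n. real (CARD('d) - card {i. x i \<noteq> 0}))"
    using card_support_add_zeros[where ?'d = 'd] by (intro sum.cong refl) (metis add_diff_cancel_left')
  also have "\<dots> = (\<Sum>i=1..CARD('d) - 1.
      real (CARD('d) - i) * 2 ^ i * real (CARD('d) choose i) * real ((n - 1) choose (i - 1)))"
    unfolding sum_sphere_card_support[OF assms, of "\<lambda>i. real (CARD('d) - i)"]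
    by (rule sum.mono_neutral_right) auto
  finally show ?thesis by (simp add: lambda_bd_def)
qed

text \<open>Swapping coordinates \<open>i\<close> and \<open>j\<close> preserves the norm.\<close>

lemma card_sphere_zero_coord:
  "card {x :: 'd::finite \<Rightarrow> int. l1norm x = n \<and> x i = 0} = card {x :: 'd \<Rightarrow> int. l1norm x = n \<and> x j = 0}"
proof -
  have norm: "l1norm (x \<circ> Transposition.transpose i j) = l1norm x" for x :: "'d \<Rightarrow> int"
    unfolding l1norm_def
    by (rule sum.reindex_bij_witness[of _ "Transposition.transpose i j" "Transposition.transpose i j"]) auto
  show ?thesis
    by (rule bij_betw_same_card[of "\<lambda>x. x \<circ> Transposition.transpose i j"],
        rule bij_betwI[where g = "\<lambda>x. x \<circ> Transposition.transpose i j"])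
       (auto simp: norm fun_eq_iff)
qed

text \<open>With \<open>Z\<close> sphere points vanishing at any given coordinate, the sum of the
  up-probabilities is \<open>(card S + Z) / 2\<close>, in which \<open>a\<close> enters only through
  its sum. Both \<lambda> and \<mu> are expressed by \<open>card S\<close> and \<open>Z\<close> as
  well.\<close>

lemma average_up_probability:
  fixes a :: "'d::finite \<Rightarrow> real"
  assumes "n \<ge> 1" and a: "2 * (\<Sum>i\<in>UNIV. a i) = 1"
  defines "S \<equiv> {x :: 'd \<Rightarrow> int. l1norm x = int n}"
  shows "(\<Sum>x\<in>S. \<Sum>i\<in>UNIV. a i * (if x i = 0 then 2 else 1)) / card S
    = lambda_bd n 2 CARD('d) / (lambda_bd n 2 CARD('d) + mu_bd n 2 CARD('d))"
proof -
  define d where "d = real CARD('d)"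
  define i0 :: 'd where "i0 = undefined"
  define Z where "Z = real (card {x\<in>S. x i0 = 0})"
  have fin: "finite S" unfolding S_def by (rule finite_sphere)
  have Z: "real (card {x\<in>S. x i = 0}) = Z" for i
    using card_sphere_zero_coord[of "int n" i i0] by (simp add: Z_def S_def)
  have Z': "(\<Sum>x\<in>S. if x i = 0 then 1 else 0) = Z" for i
    using fin by (simp add: Z[of i, symmetric] sum.If_cases Int_def)
  have zeros: "(\<Sum>x\<in>S. real (card {i. x i = 0})) = d * Z"
  proof -
    have "(\<Sum>x\<in>S. real (card {i. x i = 0})) = (\<Sum>x\<in>S. \<Sum>i\<in>UNIV. if x i = 0 then 1 else 0)"
      by (simp add: sum.If_cases)
    also have "\<dots> = (\<Sum>i\<in>UNIV. \<Sum>x\<in>S. if x i = 0 then 1 else 0)" by (rule sum.swap)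
    finally show ?thesis by (simp add: Z' d_def)
  qed
  \<comment> \<open>Double counting of pairs of a sphere point and a coordinate: the entry is either
    nonzero or zero.\<close>
  have "mu_bd n 2 CARD('d) + d * Z = (\<Sum>x\<in>S. real (card {i. x i \<noteq> 0} + card {i. x i = 0}))"
    unfolding zeros[symmetric] mu_bd_eq_sum_sphere[OF assms(1), where ?'d = 'd] S_def
    by (simp add: sum.distrib)
  also have "\<dots> = d * card S" by (simp only: card_support_add_zeros) (simp add: d_def)
  finally have mu: "mu_bd n 2 CARD('d) = d * card S - d * Z" by simp
  have lam: "lambda_bd n 2 CARD('d) = d * card S + d * Z"
    unfolding lambda_bd_eq_sum_sphere[OF assms(1), where ?'d = 'd] mu zeros[unfolded S_def] by simp
  have "(\<Sum>x\<in>S. \<Sum>i\<in>UNIV. a i * (if x i = 0 then 2 else 1))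
      = (\<Sum>i\<in>UNIV. \<Sum>x\<in>S. a i + a i * (if x i = 0 then 1 else 0))"
    by (subst sum.swap, intro sum.cong) auto
  also have "\<dots> = (\<Sum>i\<in>UNIV. a i) * (card S + Z)"
    by (simp add: sum.distrib sum_distrib_left[symmetric] Z' sum_distrib_right algebra_simps)
  also have "\<dots> = (card S + Z) / 2" using a by simp
  finally have up: "(\<Sum>x\<in>S. \<Sum>i\<in>UNIV. a i * (if x i = 0 then 2 else 1)) = (card S + Z) / 2" .
  have "d > 0" by (simp add: d_def)
  have "lambda_bd n 2 CARD('d) = (2 * d) * ((card S + Z) / 2)"
    and "lambda_bd n 2 CARD('d) + mu_bd n 2 CARD('d) = (2 * d) * card S"
    unfolding lam mu by (simp_all add: algebra_simps)
  then show ?thesis unfolding up using \<open>d > 0\<close> by simp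
qed

section \<open>The nearest-neighbour walk\<close>

text \<open>Along coordinate \<open>i\<close> both directions lead outward if
  \<open>x i = 0\<close>, and exactly one does otherwise; hence the weights 2 and 1 in the
  up-probability.\<close>

lemma l1norm_add_unit: "l1norm (x + unit_vec i) = l1norm x + (if x i \<ge> 0 then 1 else - 1)"
  and l1norm_diff_unit: "l1norm (x - unit_vec i) = l1norm x + (if x i \<le> 0 then 1 else - 1)"
proof -
  have "x + unit_vec i = x(i := x i + 1)" "x - unit_vec i = x(i := x i - 1)"
    by (auto simp: unit_vec_def fun_eq_iff)
  then show "l1norm (x + unit_vec i) = l1norm x + (if x i \<ge> 0 then 1 else - 1)"
    and "l1norm (x - unit_vec i) = l1norm x + (if x i \<le> 0 then 1 else - 1)"
    by (auto simp: l1norm_upd)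
qed

section \<open>Law of the walk on the stream space\<close>

lemma walk_Stream: "walk (s ## \<omega>) (Suc t) = s + walk \<omega> t"
  unfolding walk_def by (simp only: sum.lessThan_Suc_shift) (simp add: fun_eq_iff)

lemma walk_Suc: "walk \<omega> (Suc t) = walk \<omega> t + \<omega> !! t"
  by (auto simp: walk_def fun_eq_iff)

lemma walk_0: "walk \<omega> 0 = 0"
  by (auto simp: walk_def)

lemma measurable_walk [measurable]:
  "(\<lambda>\<omega>. walk \<omega> t) \<in> measurable (stream_space (measure_pmf q)) (count_space (UNIV :: ('d::finite \<Rightarrow> int) set))"
proof (induction t)
  case (Suc t)
  note Suc [measurable]
  show ?case unfolding walk_Suc by measurable
qed (simp add: walk_0)

lemma measurable_active_time [measurable]:
  "(\<lambda>\<omega>. active_time \<omega> j) \<in> measurable (stream_space (measure_pmf (q :: ('d::finite \<Rightarrow> int) pmf))) (count_space UNIV)"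
proof (induction j)
  case (Suc j)
  note Suc [measurable]
  show ?case unfolding active_time.simps by measurable
qed simp

text \<open>The position at time \<open>t\<close> is independent of the step indexed
  \<open>t\<close>, which leads to time \<open>t + 1\<close>. The induction peels off the first
  step, as the recursion of \<open>walk_prob\<close> does.\<close>

lemma prob_walk_step:
  fixes q :: "('d::finite \<Rightarrow> int) pmf"
  assumes "finite (set_pmf q)"
  shows "\<P>(\<omega> in stream_space q. walk \<omega> t = x \<and> \<omega> !! t \<in> A)
    = walk_prob q t x * measure_pmf.prob q A"
proof (induction t arbitrary: x)
  case 0
  have "ennreal (\<P>(\<omega> in stream_space q. walk \<omega> 0 = x \<and> \<omega> !! 0 \<in> A))
     = (\<integral>\<^sup>+s. \<P>(\<omega> in stream_space q. walk (s ## \<omega>) 0 = x \<and> (s ## \<omega>) !! 0 \<in> A) \<partial>q)"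
    by (rule prob_space.prob_stream_space[OF prob_space_measure_pmf]) measurable
  also have "\<dots> = (\<integral>\<^sup>+s. ennreal (walk_prob q 0 x) * indicator A s \<partial>q)"
  proof (rule nn_integral_cong)
    fix s
    interpret prob_space "stream_space q" by (rule prob_space.prob_space_stream_space[OF prob_space_measure_pmf])
    show "ennreal (\<P>(\<omega> in stream_space q. walk (s ## \<omega>) 0 = x \<and> (s ## \<omega>) !! 0 \<in> A))
      = ennreal (walk_prob q 0 x) * indicator A s"
      by (auto simp: walk_0 prob_space indicator_def)
  qed
  also have "\<dots> = ennreal (walk_prob q 0 x * measure_pmf.prob q A)"
    by (simp add: measure_pmf.emeasure_eq_measure)
  finally show ?case by (subst (asm) ennreal_inj) auto
next
  case (Suc t)
  have nonneg: "walk_prob q t y \<ge> 0" for t y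
    by (induction t arbitrary: y) (auto intro!: sum_nonneg)
  have "ennreal (\<P>(\<omega> in stream_space q. walk \<omega> (Suc t) = x \<and> \<omega> !! Suc t \<in> A))
     = (\<integral>\<^sup>+s. \<P>(\<omega> in stream_space q. walk (s ## \<omega>) (Suc t) = x \<and> (s ## \<omega>) !! Suc t \<in> A) \<partial>q)"
    by (rule prob_space.prob_stream_space[OF prob_space_measure_pmf]) measurable
  also have "\<dots> = (\<integral>\<^sup>+s. walk_prob q t (x - s) * measure_pmf.prob q A \<partial>q)"
    unfolding Suc[symmetric] by (simp add: walk_Stream algebra_simps)
  also have "\<dots> = (\<Sum>s\<in>set_pmf q. ennreal (walk_prob q t (x - s) * measure_pmf.prob q A) * ennreal (pmf q s))"
    by (rule nn_integral_measure_pmf_finite[OF assms]) simp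
  also have "\<dots> = ennreal (walk_prob q (Suc t) x * measure_pmf.prob q A)"
    by (simp add: ennreal_mult[symmetric] nonneg sum_distrib_left algebra_simps)
  finally show ?case
    by (subst (asm) ennreal_inj) (auto intro!: mult_nonneg_nonneg sum_nonneg nonneg)
qed

text \<open>The set of allowed next steps may depend on the current position, so the event is split
  by that position.\<close>

lemma prob_walk_in_step:
  fixes q :: "('d::finite \<Rightarrow> int) pmf"
  assumes "finite (set_pmf q)" "finite S"
  shows "\<P>(\<omega> in stream_space q. walk \<omega> t \<in> S \<and> \<omega> !! t \<in> A (walk \<omega> t))
    = (\<Sum>x\<in>S. walk_prob q t x * measure_pmf.prob q (A x))"
proof -
  interpret prob_space "stream_space q" by (rule prob_space.prob_space_stream_space[OF prob_space_measure_pmf])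
  have "{\<omega>\<in>space (stream_space q). walk \<omega> t \<in> S \<and> \<omega> !! t \<in> A (walk \<omega> t)}
      = (\<Union>x\<in>S. {\<omega>\<in>space (stream_space q). walk \<omega> t = x \<and> \<omega> !! t \<in> A x})" by auto
  also have "prob \<dots> = (\<Sum>x\<in>S. \<P>(\<omega> in stream_space q. walk \<omega> t = x \<and> \<omega> !! t \<in> A x))"
    using assms(2) by (intro finite_measure_finite_Union) (auto simp: disjoint_family_on_def)
  finally show ?thesis by (simp add: prob_walk_step[OF assms(1)])
qed

section \<open>The step distribution and the reachable points\<close>

locale nearest_neighbour_walk =
  fixes a :: "'d::finite \<Rightarrow> real"
  assumes param: "a \<in> param_set"
begin

lemma a_pos: "a i > 0" and sum_a: "2 * (\<Sum>i\<in>UNIV. a i) = 1"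
  using param by (auto simp: param_set_def)

abbreviation "q \<equiv> step_pmf a"

text \<open>\<open>embed_pmf\<close> has the intended mass function once the total mass is 1: each
  \<open>i\<close> contributes \<open>2 * a i\<close>, as the two opposite unit vectors
  differ.\<close>

lemma pmf_q: "pmf q v = (\<Sum>i\<in>UNIV. if v = unit_vec i \<or> v = - unit_vec i then a i else 0)"
proof -
  have uminus: "(\<lambda>k. - unit_vec i k) = - unit_vec i" for i :: 'd
    by (simp add: fun_Compl_def)
  have nonneg: "0 \<le> (\<Sum>i\<in>UNIV. if v = unit_vec i \<or> v = - unit_vec i then a i else 0)" for v
    using a_pos by (auto intro!: sum_nonneg simp: less_imp_le)
  have ne: "unit_vec i \<noteq> - unit_vec i" for i :: 'd
    by (auto simp: fun_eq_iff unit_vec_def)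
  have "(\<integral>\<^sup>+v. ennreal (\<Sum>i\<in>UNIV. if v = unit_vec i \<or> v = - unit_vec i then a i else 0) \<partial>count_space UNIV)
      = (\<integral>\<^sup>+v. (\<Sum>i\<in>UNIV. ennreal (a i) * indicator {unit_vec i, - unit_vec i} v) \<partial>count_space UNIV)"
  proof (intro nn_integral_cong)
    fix v
    have "ennreal (\<Sum>i\<in>UNIV. if v = unit_vec i \<or> v = - unit_vec i then a i else 0)
        = (\<Sum>i\<in>UNIV. ennreal (if v = unit_vec i \<or> v = - unit_vec i then a i else 0))"
      using a_pos by (intro sum_ennreal[symmetric]) (simp add: less_imp_le)
    also have "\<dots> = (\<Sum>i\<in>UNIV. ennreal (a i) * indicator {unit_vec i, - unit_vec i} v)"
      by (intro sum.cong) auto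
    finally show "ennreal (\<Sum>i\<in>UNIV. if v = unit_vec i \<or> v = - unit_vec i then a i else 0)
        = (\<Sum>i\<in>UNIV. ennreal (a i) * indicator {unit_vec i, - unit_vec i} v)" .
  qed
  also have "\<dots> = (\<Sum>i\<in>UNIV. \<integral>\<^sup>+v. ennreal (a i) * indicator {unit_vec i, - unit_vec i} v \<partial>count_space UNIV)"
    by (rule nn_integral_sum) simp
  also have "\<dots> = (\<Sum>i\<in>UNIV. ennreal (2 * a i))"
  proof (rule sum.cong[OF refl])
    fix i :: 'd
    have "card {unit_vec i, - unit_vec i} = 2" using ne[of i] by (metis card_2_iff)
    then have "emeasure (count_space UNIV) {unit_vec i, - unit_vec i} = 2"
      by (subst emeasure_count_space_finite) auto
    then show "(\<integral>\<^sup>+v. ennreal (a i) * indicator {unit_vec i, - unit_vec i} v \<partial>count_space UNIV) = ennreal (2 * a i)"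
      using a_pos[of i] by (subst nn_integral_cmult_indicator) (auto simp: ennreal_mult mult.commute)
  qed
  also have "\<dots> = ennreal (\<Sum>i\<in>UNIV. 2 * a i)"
    using a_pos by (intro sum_ennreal) (simp add: less_imp_le)
  also have "(\<Sum>i\<in>UNIV. 2 * a i) = 1" using sum_a by (simp add: sum_distrib_left)
  finally have total: "(\<integral>\<^sup>+v. ennreal (\<Sum>i\<in>UNIV. if v = unit_vec i \<or> v = - unit_vec i then a i else 0)
      \<partial>count_space UNIV) = 1" by (simp only: ennreal_1)
  show ?thesis
    unfolding step_pmf_def uminus by (rule pmf_embed_pmf[OF nonneg total])
qed

lemma set_q: "set_pmf q = range unit_vec \<union> range (\<lambda>i. - unit_vec i)"
proof -
  have "pmf q v \<noteq> 0 \<longleftrightarrow> (\<exists>i. v = unit_vec i \<or> v = - unit_vec i)" for v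
    unfolding pmf_q using a_pos by (subst sum_nonneg_eq_0_iff) (auto simp: less_imp_le less_imp_neq[symmetric])
  then show ?thesis by (auto simp: set_pmf_eq)
qed

lemma sum_q: "(\<Sum>v\<in>set_pmf q. pmf q v * g v) = (\<Sum>i\<in>UNIV. a i * (g (unit_vec i) + g (- unit_vec i)))"
proof -
  have ne: "unit_vec i \<noteq> - unit_vec i" for i :: 'd
    by (auto simp: fun_eq_iff unit_vec_def)
  have "(\<Sum>v\<in>set_pmf q. pmf q v * g v)
      = (\<Sum>v\<in>set_pmf q. \<Sum>i\<in>UNIV. if v = unit_vec i \<or> v = - unit_vec i then a i * g v else 0)"
    unfolding pmf_q sum_distrib_right by (intro sum.cong) auto
  also have "\<dots> = (\<Sum>i\<in>UNIV. \<Sum>v\<in>set_pmf q. if v = unit_vec i \<or> v = - unit_vec i then a i * g v else 0)"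
    by (rule sum.swap)
  also have "\<dots> = (\<Sum>i\<in>UNIV. \<Sum>v\<in>{unit_vec i, - unit_vec i}. a i * g v)"
    by (intro sum.cong refl sum.mono_neutral_cong_right) (auto simp: set_q)
  also have "\<dots> = (\<Sum>i\<in>UNIV. a i * (g (unit_vec i) + g (- unit_vec i)))"
    using ne by (simp add: algebra_simps)
  finally show ?thesis .
qed

sublocale symmetric_walk q
proof
  show "finite (set_pmf q)" by (simp add: set_q)
  show "pmf q (- v) = pmf q v" for v
  proof -
    have "- v = unit_vec i \<or> - v = - unit_vec i \<longleftrightarrow> v = unit_vec i \<or> v = - unit_vec i" for i
      by (metis minus_minus)
    then show ?thesis by (simp only: pmf_q)
  qed
qed

lemma l1norm_step: "v \<in> set_pmf q \<Longrightarrow> \<bar>l1norm (x + v) - l1norm x\<bar> = 1"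
  by (auto simp: set_q l1norm_add_unit l1norm_diff_unit)

lemma p_nonzeroD: "p m x \<noteq> 0 \<Longrightarrow> l1norm x \<le> int m \<and> (even (l1norm x) \<longleftrightarrow> even m)"
proof (induction m arbitrary: x)
  case 0
  then show ?case by (auto simp: l1norm_def split: if_splits)
next
  case (Suc m)
  then obtain v where v: "v \<in> set_pmf q" "p m (x - v) \<noteq> 0"
    by (auto elim!: sum.not_neutral_contains_not_neutral)
  have IH: "l1norm (x - v) \<le> int m" "even (l1norm (x - v)) \<longleftrightarrow> even m"
    using Suc.IH[of "x - v"] v(2) by blast+
  from l1norm_step[OF v(1), of "x - v"]
  have "l1norm x = l1norm (x - v) + 1 \<or> l1norm x = l1norm (x - v) - 1" by auto
  then show ?case using IH by auto
qed

text \<open>A nonzero point has a neighbour one closer to the origin, from which a step of positive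
  probability leads back.\<close>

lemma p_l1norm_pos: "l1norm x = int m \<Longrightarrow> p m x > 0"
proof (induction m arbitrary: x)
  case 0
  then have "x i = 0" for i using abs_le_l1norm[of x i] by simp
  then have "x = 0" by (intro ext) simp
  then show ?case by (simp add: fun_eq_iff)
next
  case (Suc m)
  have "\<exists>i. x i \<noteq> 0"
  proof (rule ccontr)
    assume "\<nexists>i. x i \<noteq> 0"
    then have "l1norm x = 0" by (simp add: l1norm_def)
    with Suc.prems show False by simp
  qed
  then obtain i where "x i \<noteq> 0" by blast
  then have "l1norm (x - unit_vec i) = int m \<or> l1norm (x - (- unit_vec i)) = int m"
    using Suc.prems by (auto simp: l1norm_add_unit l1norm_diff_unit)
  moreover have "unit_vec i \<in> set_pmf q" "- unit_vec i \<in> set_pmf q" by (auto simp: set_q)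
  ultimately show ?case using Suc.IH p_Suc_pos by blast
qed

sublocale polynomial_growth_walk q "CARD('d)"
proof
  fix m
  \<comment> \<open>In \<open>m\<close> steps the walk stays in a cube with \<open>2 * m + 1\<close>
    lattice points per side.\<close>
  have "supp m \<subseteq> {x. \<forall>i. \<bar>x i\<bar> \<le> int m}"
  proof
    fix x assume "x \<in> supp m"
    then have "l1norm x \<le> int m" using p_nonzeroD by (auto simp: supp_def)
    then show "x \<in> {x. \<forall>i. \<bar>x i\<bar> \<le> int m}" using abs_le_l1norm[of x] order_trans by blast
  qed
  then have "card (supp m) \<le> card {x :: 'd \<Rightarrow> int. \<forall>i. \<bar>x i\<bar> \<le> int m}"
    by (intro card_mono finite_box)
  also have "\<dots> = (2 * m + 1) ^ CARD('d)"
    by (subst card_box) (auto simp: nat_add_distrib nat_mult_distrib)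
  finally show "card (supp m) \<le> (2 * m + 1) ^ CARD('d)" .
qed

text \<open>Adding \<open>n mod 2\<close> selects the times of the same parity as the norm. The
  common limit 1 is the asymptotic uniformity on the sphere.\<close>

lemma p_ratio_tendsto:
  assumes "l1norm x = int n"
  shows "(\<lambda>m. p (2 * m + n mod 2) x / u m) \<longlonglongrightarrow> 1"
proof -
  have even_pos: "\<exists>k. p (2 * k) y > 0" if ev: "even (l1norm y)" for y
  proof -
    obtain k where "l1norm y = 2 * k" using ev by (rule evenE)
    then have "l1norm y = int (2 * nat k)" using l1norm_nonneg[of y] by simp
    then show ?thesis using p_l1norm_pos by blast
  qed
  show ?thesis
  proof (cases "even n")
    case True
    then show ?thesis using even_pos[of x] p_even_ratio_tendsto assms by auto
  next
    case False
    have "\<exists>k. p (2 * k) (x - v) > 0" if "v \<in> set_pmf q" for v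
    proof (rule even_pos)
      from l1norm_step[OF that, of "x - v"]
      have "l1norm x = l1norm (x - v) + 1 \<or> l1norm x = l1norm (x - v) - 1" by auto
      then show "even (l1norm (x - v))" using False assms by (metis even_add even_diff even_of_nat odd_one)
    qed
    then show ?thesis using p_odd_ratio_tendsto[of x] False by (simp add: odd_iff_mod_2_eq_one)
  qed
qed

lemma prob_step_up:
  "measure_pmf.prob q {v. l1norm (x + v) = l1norm x + 1} = (\<Sum>i\<in>UNIV. a i * (if x i = 0 then 2 else 1))"
proof -
  define A where "A = {v. l1norm (x + v) = l1norm x + 1}"
  have "measure_pmf.prob q A = measure_pmf.prob q (A \<inter> set_pmf q)"
    by (simp add: measure_Int_set_pmf)
  also have "\<dots> = (\<Sum>v\<in>A \<inter> set_pmf q. pmf q v)"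
    using finite_steps by (intro measure_measure_pmf_finite) auto
  also have "\<dots> = (\<Sum>v\<in>set_pmf q. pmf q v * indicator A v)"
    using finite_steps by (intro sum.mono_neutral_cong_left) (auto simp: indicator_def split: if_splits)
  also have "\<dots> = (\<Sum>i\<in>UNIV. a i * (if x i = 0 then 2 else 1))"
    unfolding sum_q by (intro sum.cong refl) (auto simp: A_def indicator_def l1norm_add_unit l1norm_diff_unit)
  finally show ?thesis by (simp add: A_def)
qed

section \<open>Active times and the limiting conditional probabilities\<close>

sublocale W: prob_space "walk_space a"
  unfolding walk_space_def by (rule prob_space.prob_space_stream_space[OF prob_space_measure_pmf])

text \<open>Almost surely all steps are signed unit vectors, so the norm changes at every time and
  the least later time is the next one.\<close>

lemma AE_active_time: "AE \<omega> in walk_space a. \<forall>j. active_time \<omega> j = j"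
proof -
  have "AE \<omega> in walk_space a. stream_all (\<lambda>v. v \<in> set_pmf q) \<omega>"
    unfolding walk_space_def by (rule prob_space.AE_stream_all[OF prob_space_measure_pmf]) (auto simp: AE_measure_pmf)
  then show ?thesis
  proof eventually_elim
    case (elim \<omega>)
    then have "l1norm (walk \<omega> (Suc t)) \<noteq> l1norm (walk \<omega> t)" for t
      using l1norm_step[of "\<omega> !! t" "walk \<omega> t"] by (auto simp: walk_Suc stream_all_def)
    then have "active_time \<omega> j = j" for j
      by (induction j) (auto intro!: Least_equality)
    then show ?case by blast
  qed
qed

lemma measure_cond_event:
  "measure (walk_space a) (cond_event a j n) = (\<Sum>x | l1norm x = int n. p j x)"
proof -
  \<comment> \<open>The vacuous condition on the next step gives the event the shape of
    \<open>prob_walk_in_step\<close>.\<close>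
  have "measure (walk_space a) (cond_event a j n)
      = \<P>(\<omega> in walk_space a. walk \<omega> j \<in> {x. l1norm x = int n} \<and> \<omega> !! j \<in> UNIV)"
    unfolding cond_event_def
  proof (rule measure_eq_AE)
    show "AE \<omega> in walk_space a. (\<omega> \<in> {\<omega> \<in> space (walk_space a). l1norm (walk \<omega> (active_time \<omega> j)) = int n})
       = (\<omega> \<in> {\<omega> \<in> space (walk_space a). walk \<omega> j \<in> {x. l1norm x = int n} \<and> \<omega> !! j \<in> UNIV})"
      using AE_active_time by eventually_elim auto
  qed (unfold walk_space_def, measurable)
  also have "\<dots> = (\<Sum>x | l1norm x = int n. p j x)"
    unfolding walk_space_def
    using prob_walk_in_step[OF finite_steps finite_sphere, where t = j and A = "\<lambda>_. UNIV"] by simp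
  finally show ?thesis .
qed

lemma measure_joint_event:
  "measure (walk_space a) (joint_event a j n)
    = (\<Sum>x | l1norm x = int n. p j x * (\<Sum>i\<in>UNIV. a i * (if x i = 0 then 2 else 1)))"
proof -
  define A where "A x = {v. l1norm (x + v) = l1norm x + 1}" for x :: "'d \<Rightarrow> int"
  have "measure (walk_space a) (joint_event a j n)
      = \<P>(\<omega> in walk_space a. walk \<omega> j \<in> {x. l1norm x = int n} \<and> \<omega> !! j \<in> A (walk \<omega> j))"
    unfolding cond_event_def joint_event_def
  proof (rule measure_eq_AE)
    show "AE \<omega> in walk_space a. (\<omega> \<in> {\<omega> \<in> {\<omega> \<in> space (walk_space a). l1norm (walk \<omega> (active_time \<omega> j)) = int n}.
         l1norm (walk \<omega> (active_time \<omega> (Suc j))) = int n + 1})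
       = (\<omega> \<in> {\<omega> \<in> space (walk_space a). walk \<omega> j \<in> {x. l1norm x = int n} \<and> \<omega> !! j \<in> A (walk \<omega> j)})"
      using AE_active_time by eventually_elim (auto simp del: active_time.simps simp: A_def walk_Suc)
  qed (unfold walk_space_def A_def mem_Collect_eq walk_Suc[symmetric] conj_assoc, measurable)
  also have "\<dots> = (\<Sum>x | l1norm x = int n. p j x * measure_pmf.prob q (A x))"
    unfolding walk_space_def by (rule prob_walk_in_step[OF finite_steps finite_sphere])
  finally show ?thesis unfolding A_def prob_step_up .
qed

text \<open>Numerator and denominator are both divided by \<open>u m\<close>, after which each is a
  finite sum of convergent terms over the sphere.\<close>

lemma P_tj_tendsto:
  fixes n :: nat
  defines "S \<equiv> {x :: 'd \<Rightarrow> int. l1norm x = int n}"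
  defines "L \<equiv> (\<Sum>x\<in>S. \<Sum>i\<in>UNIV. a i * (if x i = 0 then 2 else 1)) / card S"
  shows "\<exists>\<^sub>\<infinity>j. measure (walk_space a) (cond_event a j n) > 0"
    and "(P_tj a n \<longlongrightarrow> L) (adm_filter a n)"
proof -
  define c where "c j = measure (walk_space a) (cond_event a j n)" for j
  define b where "b j = measure (walk_space a) (joint_event a j n)" for j
  define \<tau> where "\<tau> m = 2 * m + n mod 2" for m :: nat
  \<comment> \<open>A point on a coordinate axis shows that the sphere is nonempty, so the limiting
    denominator is positive.\<close>
  have "(\<lambda>_. 0)(undefined := int n) \<in> S" by (auto simp: S_def l1norm_upd) (simp add: l1norm_def)
  then have "card S > 0" using finite_sphere[of "int n"] by (auto simp: S_def card_gt_0_iff)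
  have "(\<lambda>m. \<Sum>x\<in>S. p (\<tau> m) x / u m) \<longlonglongrightarrow> (\<Sum>x\<in>S. 1)"
    unfolding \<tau>_def by (intro tendsto_sum p_ratio_tendsto) (simp add: S_def)
  then have c: "(\<lambda>m. c (\<tau> m) / u m) \<longlonglongrightarrow> card S"
    unfolding c_def measure_cond_event by (simp add: S_def sum_divide_distrib)
  have "(\<lambda>m. \<Sum>x\<in>S. p (\<tau> m) x / u m * (\<Sum>i\<in>UNIV. a i * (if x i = 0 then 2 else 1)))
      \<longlonglongrightarrow> (\<Sum>x\<in>S. 1 * (\<Sum>i\<in>UNIV. a i * (if x i = 0 then 2 else 1)))"
    unfolding \<tau>_def by (intro tendsto_sum tendsto_mult tendsto_const p_ratio_tendsto) (simp add: S_def)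
  then have "(\<lambda>m. b (\<tau> m) / u m) \<longlonglongrightarrow> (\<Sum>x\<in>S. \<Sum>i\<in>UNIV. a i * (if x i = 0 then 2 else 1))"
    unfolding b_def measure_joint_event by (simp add: S_def sum_divide_distrib)
  from tendsto_divide[OF this c] have "(\<lambda>m. b (\<tau> m) / u m / (c (\<tau> m) / u m)) \<longlonglongrightarrow> L"
    using \<open>card S > 0\<close> by (simp add: L_def)
  then have lim: "(\<lambda>m. P_tj a n (\<tau> m)) \<longlonglongrightarrow> L"
    using u_pos by (simp add: P_tj_def b_def c_def less_imp_neq[symmetric])
  have "eventually (\<lambda>m. c (\<tau> m) / u m > 0) sequentially"
    using order_tendstoD(1)[OF c, of 0] \<open>card S > 0\<close> by simp
  then have "eventually (\<lambda>m. c (\<tau> m) > 0) sequentially"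
    by eventually_elim (metis u_pos zero_less_divide_iff less_asym)
  then obtain N where N: "c (\<tau> m) > 0" if "m \<ge> N" for m
    by (auto simp: eventually_sequentially)
  show "\<exists>\<^sub>\<infinity>j. measure (walk_space a) (cond_event a j n) > 0"
    unfolding INFM_nat_le
  proof
    fix k
    have "\<tau> (max N k) \<ge> k" by (simp add: \<tau>_def)
    then show "\<exists>j\<ge>k. measure (walk_space a) (cond_event a j n) > 0"
      using N[of "max N k"] by (auto simp: c_def)
  qed
  \<comment> \<open>Admissible times have the parity of \<open>n\<close>, hence are values of
    \<tau>; substituting \<open>m = j div 2\<close> carries the limit over to
    \<open>adm_filter\<close>.\<close>
  have parity: "\<tau> (j div 2) = j" if pos: "c j > 0" for j
  proof -
    obtain x where "x \<in> S" "p j x \<noteq> 0"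
      using pos unfolding c_def measure_cond_event S_def
      by (metis (mono_tags, lifting) less_irrefl sum.neutral)
    then have "j mod 2 = n mod 2" using p_nonzeroD[of j x] by (auto simp: S_def mod2_eq_if)
    then show ?thesis using mult_div_mod_eq[of 2 j] by (simp add: \<tau>_def)
  qed
  have "filterlim (\<lambda>j::nat. j div 2) sequentially (adm_filter a n)"
  proof (rule filterlim_mono)
    show "filterlim (\<lambda>j::nat. j div 2) sequentially sequentially"
      unfolding filterlim_at_top eventually_sequentially
    proof
      fix Z :: nat
      show "\<exists>N. \<forall>j\<ge>N. Z \<le> j div 2" by (intro exI[of _ "2 * Z"]) auto
    qed
  qed (auto simp: adm_filter_def)
  from filterlim_compose[OF lim this]
  have "((\<lambda>j. P_tj a n (\<tau> (j div 2))) \<longlongrightarrow> L) (adm_filter a n)" .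
  moreover have "eventually (\<lambda>j. P_tj a n (\<tau> (j div 2)) = P_tj a n j) (adm_filter a n)"
    unfolding adm_filter_def eventually_inf_principal using parity by (auto simp: c_def)
  ultimately show "(P_tj a n \<longlongrightarrow> L) (adm_filter a n)"
    by (rule Lim_transform_eventually)
qed

lemma limit_exists: "limit_exists a n"
  unfolding limit_exists_def using P_tj_tendsto[of n] by blast

text \<open>Infinitely many admissible times make the filter nontrivial, so \<open>Lim\<close> is
  the unique limit.\<close>

lemma p_lim_eq_average:
  fixes n :: nat
  defines "S \<equiv> {x :: 'd \<Rightarrow> int. l1norm x = int n}"
  shows "p_lim a n = (\<Sum>x\<in>S. \<Sum>i\<in>UNIV. a i * (if x i = 0 then 2 else 1)) / card S"
proof -
  have "adm_filter a n \<noteq> bot"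
    using P_tj_tendsto(1)[of n]
    by (auto simp: adm_filter_def trivial_limit_def eventually_inf_principal frequently_def cofinite_eq_sequentially)
  then show ?thesis
    unfolding p_lim_def S_def by (rule tendsto_Lim[OF _ P_tj_tendsto(2)])
qed

text \<open>From the origin every step leads outward. Conservativity includes \<open>n = 0\<close>,
  where the quotient formula is not asserted.\<close>

lemma p_lim_0: "p_lim a 0 = 1"
proof -
  have "{x :: 'd \<Rightarrow> int. l1norm x = int 0} = {0}"
    by (auto simp: l1norm_def sum_nonneg_eq_0_iff fun_eq_iff)
  then show ?thesis
    unfolding p_lim_eq_average using sum_a by (simp add: sum_distrib_right[symmetric] mult.commute)
qed

lemma p_lim_eq:
  "n \<ge> 1 \<Longrightarrow> p_lim a n = lambda_bd n 2 CARD('d) / (lambda_bd n 2 CARD('d) + mu_bd n 2 CARD('d))"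
  unfolding p_lim_eq_average by (rule average_up_probability[OF _ sum_a])

end

theorem theorem2p1:
  assumes "CARD('d::finite) \<ge> 2"
  shows "conservative (param_set :: ('d \<Rightarrow> real) set) \<and>
    (\<forall>a \<in> (param_set :: ('d \<Rightarrow> real) set). \<forall>n \<ge> 1.
       p_lim a n = lambda_bd n 2 CARD('d) / (lambda_bd n 2 CARD('d) + mu_bd n 2 CARD('d)))"
proof -
  have walk: "nearest_neighbour_walk a" if "a \<in> param_set" for a :: "'d \<Rightarrow> real"
    using that by unfold_locales
  \<comment> \<open>For positive \<open>n\<close> both limits equal the same expression, which is
    free of the parameters; \<open>n = 0\<close> is the case \<open>p_lim_0\<close>.\<close>
  have "p_lim a1 n = p_lim a2 n" if "a1 \<in> param_set" "a2 \<in> param_set" for a1 a2 :: "'d \<Rightarrow> real" and n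
    using that[THEN walk] by (cases n) (simp_all add: nearest_neighbour_walk.p_lim_0 nearest_neighbour_walk.p_lim_eq)
  then have "conservative (param_set :: ('d \<Rightarrow> real) set)"
    unfolding conservative_def using walk nearest_neighbour_walk.limit_exists by blast
  then show ?thesis using walk nearest_neighbour_walk.p_lim_eq by blast
qed

end
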